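(* Let $G$ be the simply connected 4-dimensional Lie group whose Lie algebra has a basis $X_1,X_2,X_3,X_4$ with $$[X_1,X_4]=[X_2,X_4]=[X_3,X_4]=0,\quad [X_2,X_3]=X_1,\quad [X_3,X_1]=X_2,\quad [X_1,X_2]=X_3 .$$ For real numbers $a_1,a_2,a_3$ let $$Y_1=X_1,\quad Y_2=X_2,\quad Y_3=X_3,\quad Y_4=a_1X_1+a_2X_2+a_3X_3+X_4 .$$ Suppose the left-invariant metric $g_0$ on $G$ is diagonal in the basis $Y_i$, i.e. $g_0(Y_i,Y_j)=\lambda_i\delta_{ij}$ with $\lambda_i>0$. Let $g(t)$ be the Ricci flow solution with $g(0)=g_0$. Then: (i) if $\lambda_1,\lambda_2,\lambda_3$ are all different, $g(t)$ remains diagonal in the basis $Y_i$ if and only if $a_1=a_2=a_3=0$; (ii) if $\lambda_j=\lambda_k\ne\lambda_i$ for some permutation $\{i,j,k\}$ of $\{1,2,3\}$, $g(t)$ remains diagonal in the basis $Y_i$ if and only if $a_j=a_k=0$; and (iii) if $\lambda_1=\lambda_2=\lambda_3$, $g(t)$ remains diagonal in the basis $Y_i$ for any $a_1,a_2,a_3$.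
   Context: Elements of the Lie algebra are identified with left-invariant vector fields on $G$. The Ricci flow solution $g(t)$ is the left-invariant solution of $\frac{\partial}{\partial t}g(t)=-2\operatorname{Ric}(g(t))$, $g(0)=g_0$ (equivalently, the solution of the corresponding ODE on inner products on the Lie algebra). "$g(t)$ remains diagonal in the basis $Y_1,\dots,Y_4$" means that the off-diagonal components of $g(t)$ in this basis vanish for all $t\ge0$ in its maximal interval of existence. *)

theory Defs
  imports "HOL-Analysis.Analysis"
begin

text \<open>
  A left-invariant tensor field on a Lie group is determined by its value on the Lie algebra of
  left-invariant vector fields. A left-invariant metric is therefore an inner product on the Lie
  algebra, and its Levi-Civita connection, curvature and Ricci tensor are multilinear maps on the
  Lie algebra. The finite-dimensional Lie algebra is a real vector space with an explicit bracket.
\<close>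

locale lie_algebra =
  fixes br :: "'a::real_vector \<Rightarrow> 'a \<Rightarrow> 'a"
  assumes bilinear: "bilinear br"
    and alternating: "br x x = 0"
    and jacobi: "br x (br y z) + br y (br z x) + br z (br x y) = 0"

definition basis_family :: "('i \<Rightarrow> 'a::real_vector) \<Rightarrow> 'i set \<Rightarrow> bool" where
  "basis_family X I \<longleftrightarrow> inj_on X I \<and> independent (X ` I) \<and> span (X ` I) = UNIV"

definition inner_product :: "('a::real_vector \<Rightarrow> 'a \<Rightarrow> real) \<Rightarrow> bool" where
  "inner_product g \<longleftrightarrow>
     bilinear g \<and> (\<forall>u v. g u v = g v u) \<and> (\<forall>u. u \<noteq> 0 \<longrightarrow> g u u > 0)"

text \<open>
  If \<open>u\<close>, \<open>v\<close>, \<open>w\<close> are left-invariant, then \<open>g v w\<close> is a constant function on the group, so the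
  derivative of \<open>g v w\<close> along \<open>u\<close> in the metric compatibility condition vanishes.
\<close>

definition is_levi_civita ::
  "('a::real_vector \<Rightarrow> 'a \<Rightarrow> 'a) \<Rightarrow> ('a \<Rightarrow> 'a \<Rightarrow> real) \<Rightarrow> ('a \<Rightarrow> 'a \<Rightarrow> 'a) \<Rightarrow> bool" where
  "is_levi_civita br g D \<longleftrightarrow>
     bilinear D \<and>
     (\<forall>u v. D u v - D v u = br u v) \<and>
     (\<forall>u v w. g (D u v) w + g v (D u w) = 0)"

definition levi_civita ::
  "('a::real_vector \<Rightarrow> 'a \<Rightarrow> 'a) \<Rightarrow> ('a \<Rightarrow> 'a \<Rightarrow> real) \<Rightarrow> 'a \<Rightarrow> 'a \<Rightarrow> 'a" where
  "levi_civita br g = (THE D. is_levi_civita br g D)"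

definition riemann ::
  "('a::real_vector \<Rightarrow> 'a \<Rightarrow> 'a) \<Rightarrow> ('a \<Rightarrow> 'a \<Rightarrow> real) \<Rightarrow> 'a \<Rightarrow> 'a \<Rightarrow> 'a \<Rightarrow> 'a" where
  "riemann br g u v w =
     (let D = levi_civita br g in D u (D v w) - D v (D u w) - D (br u v) w)"

text \<open>
  The set \<open>real_vector.extend_basis {}\<close> is an arbitrary basis of the whole space; for a linear
  map on a finite-dimensional space the value does not depend on it.
\<close>

definition lin_trace :: "('a::real_vector \<Rightarrow> 'a) \<Rightarrow> real" where
  "lin_trace f =
     (\<Sum>b\<in>real_vector.extend_basis {}. real_vector.representation (real_vector.extend_basis {}) (f b) b)"

definition ricci ::
  "('a::real_vector \<Rightarrow> 'a \<Rightarrow> 'a) \<Rightarrow> ('a \<Rightarrow> 'a \<Rightarrow> real) \<Rightarrow> 'a \<Rightarrow> 'a \<Rightarrow> real" where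
  "ricci br g v w = lin_trace (\<lambda>u. riemann br g u v w)"

text \<open>
  Solutions live on the forward interval \<open>[0, T)\<close> with \<open>0 < T \<le> \<infinity>\<close>; the derivative at \<open>0\<close> is
  one-sided. An equation between bilinear forms is stated on every pair of vectors.
\<close>

definition time_interval :: "ereal \<Rightarrow> real set" where
  "time_interval T = {t. 0 \<le> t \<and> ereal t < T}"

definition ricci_flow_on ::
  "('a::real_vector \<Rightarrow> 'a \<Rightarrow> 'a) \<Rightarrow> (real \<Rightarrow> 'a \<Rightarrow> 'a \<Rightarrow> real) \<Rightarrow> ereal \<Rightarrow> bool" where
  "ricci_flow_on br g T \<longleftrightarrow>
     0 < T \<and>
     (\<forall>t\<in>time_interval T.
        inner_product (g t) \<and>
        (\<forall>u v. ((\<lambda>s. g s u v) has_real_derivative - 2 * ricci br (g t) u v)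
                 (at t within time_interval T)))"

definition maximal_ricci_flow ::
  "('a::real_vector \<Rightarrow> 'a \<Rightarrow> 'a) \<Rightarrow> (real \<Rightarrow> 'a \<Rightarrow> 'a \<Rightarrow> real) \<Rightarrow> ereal \<Rightarrow> bool" where
  "maximal_ricci_flow br g T \<longleftrightarrow>
     ricci_flow_on br g T \<and>
     \<not> (\<exists>h T'. T < T' \<and> ricci_flow_on br h T' \<and> (\<forall>t\<in>time_interval T. h t = g t))"

definition remains_diagonal ::
  "(real \<Rightarrow> 'a \<Rightarrow> 'a \<Rightarrow> real) \<Rightarrow> ereal \<Rightarrow> ('i \<Rightarrow> 'a) \<Rightarrow> 'i set \<Rightarrow> bool" where
  "remains_diagonal g T Y I \<longleftrightarrow>
     (\<forall>t\<in>time_interval T. \<forall>i\<in>I. \<forall>j\<in>I. i \<noteq> j \<longrightarrow> g t (Y i) (Y j) = 0)"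

end

theory Submission
  imports Defs "HOL-Library.Landau_Symbols"
begin

text \<open>
  In the frame \<open>Y\<close>, for every diagonal metric with entries \<open>\<mu>\<close> one has
  \<open>Ric(Y\<^sub>i, Y\<^sub>4) = - a\<^sub>i (\<mu>\<^sub>j - \<mu>\<^sub>k)\<^sup>2 / (2 \<mu>\<^sub>j \<mu>\<^sub>k)\<close>, so the flow can stay
  diagonal only if \<open>a\<^sub>i = 0\<close> or \<open>\<lambda>\<^sub>j = \<lambda>\<^sub>k\<close> for every permutation \<open>(i, j, k)\<close> of \<open>(1, 2, 3)\<close>;
  all three claims are instances of this condition. Conversely, under this condition consider the
  diagonal metrics \<open>\<mu>\<close> with \<open>\<mu>\<^sub>j = \<mu>\<^sub>k\<close> whenever \<open>\<lambda>\<^sub>j = \<lambda>\<^sub>k\<close>. The Ricci tensor is tangent to this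
  family and is a Lipschitz function of the metric along a compact piece of the flow, so the
  deviation of the flow from the family satisfies a Gronwall inequality and vanishes.
\<close>

section \<open>Frames and the trace\<close>

text \<open>The basis is indexed by a finite type, so that sums run over \<open>UNIV\<close> and
  coefficient vectors live in \<open>real^'n\<close>, although \<open>'a\<close> itself is only a
  real vector space.\<close>

locale frame =
  fixes e :: "'n::finite \<Rightarrow> 'a::real_vector"
  assumes inj_frame: "inj e"
    and independent_frame: "independent (range e)"
    and span_frame: "span (range e) = UNIV"
begin

definition coord :: "'a \<Rightarrow> 'n \<Rightarrow> real" where
  "coord v i = representation (range e) v (e i)"

lemma coord_add: "coord (u + v) i = coord u i + coord v i"
  by (simp add: coord_def representation_add independent_frame span_frame)

lemma coord_scaleR: "coord (c *\<^sub>R v) i = c * coord v i"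
  by (simp add: coord_def representation_scale independent_frame span_frame)

lemma linear_coord: "linear (\<lambda>v. coord v i)"
  by (rule linearI) (simp_all add: coord_add coord_scaleR)

lemmas coord_simps = coord_add coord_scaleR linear_0[OF linear_coord] linear_diff[OF linear_coord]
  linear_neg[OF linear_coord] linear_sum[OF linear_coord]

lemma coord_frame: "coord (e i) j = (if i = j then 1 else 0)"
  using inj_frame
  by (auto simp: coord_def representation_basis independent_frame inj_eq)

lemma expand: "(\<Sum>i\<in>UNIV. coord v i *\<^sub>R e i) = v"
proof -
  have "(\<Sum>b\<in>range e. representation (range e) v b *\<^sub>R b) = v"
    by (rule sum_representation_eq) (auto simp: independent_frame span_frame)
  then show ?thesis
    by (simp add: coord_def sum.reindex[OF inj_frame] o_def)
qed

lemma linear_expand: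
  assumes "linear f"
  shows "f v = (\<Sum>i\<in>UNIV. coord v i *\<^sub>R f (e i))"
proof -
  have "f v = f (\<Sum>i\<in>UNIV. coord v i *\<^sub>R e i)"
    by (simp add: expand)
  also have "\<dots> = (\<Sum>i\<in>UNIV. coord v i *\<^sub>R f (e i))"
    using assms by (simp add: linear_sum linear_cmul)
  finally show ?thesis .
qed

text \<open>\<open>lin_trace\<close> sums over an arbitrary basis \<open>B\<close>. Expanding each
  \<open>b\<close> of \<open>B\<close> in the frame and exchanging the sums reassembles the
  \<open>B\<close>-expansion of \<open>f (e i)\<close>, which leaves the trace taken in the
  frame.\<close>

lemma lin_trace_coord:
  assumes f: "linear f"
  shows "lin_trace f = (\<Sum>i\<in>UNIV. coord (f (e i)) i)"
proof -
  define B where "B = real_vector.extend_basis ({} :: 'a set)"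
  have indB: "independent B"
    unfolding B_def by (rule independent_extend_basis) (rule independent_empty)
  have spanB: "span B = UNIV"
    unfolding B_def by (rule span_extend_basis) (rule independent_empty)
  \<comment> \<open>An independent set in the span of a finite frame is finite; a sum over an
    infinite \<open>B\<close> would be \<open>0\<close> by default.\<close>
  have finB: "finite B"
    using independent_span_bound[of "range e" B] indB by (simp add: span_frame)
  let ?rep = "representation B"
  have linrep: "linear (\<lambda>v. ?rep v b)" for b
    by (rule linearI) (simp_all add: representation_add representation_scale indB spanB)
  have sumrep: "(\<Sum>b\<in>B. ?rep v b *\<^sub>R b) = v" for v
    by (rule sum_representation_eq) (auto simp: indB spanB finB)
  have "lin_trace f = (\<Sum>b\<in>B. ?rep (f b) b)"
    unfolding lin_trace_def B_def ..
  also have "\<dots> = (\<Sum>b\<in>B. \<Sum>i\<in>UNIV. coord b i * ?rep (f (e i)) b)"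
  proof (rule sum.cong)
    show "?rep (f b) b = (\<Sum>i\<in>UNIV. coord b i * ?rep (f (e i)) b)" for b
      using linear_expand[OF linear_compose[OF f linrep[of b]], of b]
      by (simp only: o_def real_scaleR_def)
  qed simp
  also have "\<dots> = (\<Sum>i\<in>UNIV. \<Sum>b\<in>B. coord b i * ?rep (f (e i)) b)"
    by (rule sum.swap)
  also have "\<dots> = (\<Sum>i\<in>UNIV. coord (\<Sum>b\<in>B. ?rep (f (e i)) b *\<^sub>R b) i)"
    by (simp add: coord_simps mult.commute)
  finally show ?thesis
    by (simp add: sumrep)
qed

end

section \<open>Inner products and Riesz representation\<close>

lemma inner_productD:
  assumes "inner_product g"
  shows "linear (g u)" "linear (\<lambda>v. g v u)" "g u v = g v u" "u \<noteq> 0 \<Longrightarrow> g u u > 0"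
  using assms by (auto simp: inner_product_def bilinear_def)

lemma inner_product_eqI:
  assumes g: "inner_product g" and eq: "\<And>w. g u w = g v w"
  shows "u = v"
proof -
  have "g (u - v) (u - v) = 0"
    using eq[of "u - v"] by (simp add: linear_diff[OF inner_productD(2)[OF g]])
  then show ?thesis
    using inner_productD(4)[OF g, of "u - v"] by force
qed

lemmas inner_simps = linear_add[OF inner_productD(1)] linear_diff[OF inner_productD(1)]
  linear_neg[OF inner_productD(1)] linear_cmul[OF inner_productD(1)] linear_0[OF inner_productD(1)]
  linear_sum[OF inner_productD(1)]
  linear_add[OF inner_productD(2)] linear_diff[OF inner_productD(2)]
  linear_neg[OF inner_productD(2)] linear_cmul[OF inner_productD(2)] linear_0[OF inner_productD(2)]
  linear_sum[OF inner_productD(2)]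

context frame
begin

lemma inner_expand:
  assumes "inner_product g"
  shows "g u v = (\<Sum>i\<in>UNIV. coord u i * g (e i) v)"
  using linear_expand[OF inner_productD(2)[OF assms], of u v] by (simp only: real_scaleR_def)

lemma inner_expand2:
  assumes "inner_product g"
  shows "g u v = (\<Sum>i\<in>UNIV. \<Sum>j\<in>UNIV. coord u i * coord v j * g (e i) (e j))"
proof -
  have "g (e i) v = (\<Sum>j\<in>UNIV. coord v j * g (e i) (e j))" for i
    using linear_expand[OF inner_productD(1)[OF assms], of "e i" v] by (simp only: real_scaleR_def)
  then show ?thesis
    by (subst inner_expand[OF assms]) (simp only: sum_distrib_left mult.assoc)
qed

text \<open>The Gram map \<open>L\<close> is injective because \<open>g\<close> is definite, and an
  injective linear endomorphism of \<open>real^'n\<close> is surjective, so it attains the values of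
  \<open>f\<close> on the frame.\<close>

lemma riesz:
  fixes g :: "'a \<Rightarrow> 'a \<Rightarrow> real"
  assumes g: "inner_product g" and f: "linear f"
  shows "\<exists>r. \<forall>w. g r w = f w"
proof -
  define vec :: "real^'n \<Rightarrow> 'a" where "vec x = (\<Sum>i\<in>UNIV. x $ i *\<^sub>R e i)" for x
  define L :: "real^'n \<Rightarrow> real^'n" where "L x = (\<chi> j. g (vec x) (e j))" for x
  have coord_vec: "coord (vec x) i = x $ i" for x i
    by (simp add: vec_def coord_simps coord_frame if_distrib cong: if_cong)
  have "linear vec"
    by (rule linearI) (simp_all add: vec_def scaleR_left_distrib sum.distrib scaleR_sum_right)
  then have L: "linear L"
    by (intro linearI) (simp_all add: L_def vec_eq_iff linear_add linear_cmul inner_simps[OF g])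
  have "inj L"
  proof (rule injI)
    fix x y assume "L x = L y"
    then have "g (vec x) (e j) = g (vec y) (e j)" for j
      by (simp add: L_def vec_eq_iff)
    then have "g (vec x) w = g (vec y) w" for w
      using linear_expand[OF inner_productD(1)[OF g], of "vec x" w]
        linear_expand[OF inner_productD(1)[OF g], of "vec y" w] by simp
    then have "vec x = vec y"
      by (rule inner_product_eqI[OF g])
    then show "x = y"
      by (metis coord_vec vec_eq_iff)
  qed
  then obtain x where x: "L x = (\<chi> j. f (e j))"
    using linear_injective_imp_surjective[OF L] by (metis surjD)
  then have "g (vec x) (e j) = f (e j)" for j
    by (simp add: L_def vec_eq_iff)
  then have "g (vec x) w = f w" for w
    using linear_expand[OF inner_productD(1)[OF g], of "vec x" w] linear_expand[OF f, of w] by simp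
  then show ?thesis
    by blast
qed

end

section \<open>The Levi-Civita connection and the Ricci tensor in a frame\<close>

text \<open>The right-hand side of the Koszul formula; its derivative terms are absent because
  \<open>g\<close> is constant on left-invariant fields.\<close>

definition koszul :: "('a::real_vector \<Rightarrow> 'a \<Rightarrow> 'a) \<Rightarrow> ('a \<Rightarrow> 'a \<Rightarrow> real) \<Rightarrow> 'a \<Rightarrow> 'a \<Rightarrow> 'a \<Rightarrow> real" where
  "koszul br g u v w = (g (br u v) w - g (br v w) u + g (br w u) v) / 2"

locale framed_lie_algebra = lie_algebra br + frame e
  for br :: "'a::real_vector \<Rightarrow> 'a \<Rightarrow> 'a" and e :: "'n::finite \<Rightarrow> 'a"
begin

lemma br_linear: "linear (br u)" "linear (\<lambda>v. br v u)"
  using bilinear by (auto simp: bilinear_def)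

lemmas br_simps = linear_add[OF br_linear(1)] linear_diff[OF br_linear(1)]
  linear_cmul[OF br_linear(1)] linear_add[OF br_linear(2)] linear_diff[OF br_linear(2)]
  linear_cmul[OF br_linear(2)]

lemma br_antisym: "br u v = - br v u"
proof -
  have "br u v + br v u = br (u + v) (u + v)"
    unfolding br_simps by (simp only: alternating add_0_left add_0_right add.commute)
  then have "br u v + br v u = 0"
    by (simp only: alternating)
  then show ?thesis
    by (simp add: eq_neg_iff_add_eq_0)
qed

text \<open>Torsion-freeness turns the three brackets into six terms. By metric compatibility two
  pairs cancel and the third adds up to twice \<open>g (D u v) w\<close>. Uniqueness of the
  connection follows.\<close>

lemma is_levi_civita_koszul:
  assumes g: "inner_product g" and D: "is_levi_civita br g D"
  shows "g (D u v) w = koszul br g u v w"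
proof -
  have br: "br x y = D x y - D y x" for x y
    using D by (simp add: is_levi_civita_def)
  have met: "g (D x y) z = - g (D x z) y" for x y z
  proof -
    have "g (D x y) z + g y (D x z) = 0"
      using D by (simp add: is_levi_civita_def)
    then show ?thesis
      using inner_productD(3)[OF g, of y "D x z"] by simp
  qed
  show ?thesis
    unfolding koszul_def br inner_simps[OF g]
    using met[of v u w] met[of w v u] met[of u v w] by simp
qed

text \<open>Riesz representation of the Koszul functional supplies \<open>D u v\<close>; bilinearity
  and torsion-freeness are then tested by pairing with an arbitrary \<open>w\<close>.\<close>

lemma levi_civita_exists:
  assumes g: "inner_product g"
  shows "\<exists>D. is_levi_civita br g D"
proof -
  have "linear (koszul br g u v)" for u v
    unfolding koszul_def
    by (rule linearI) (simp_all add: br_simps inner_simps[OF g] field_simps)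
  then have "\<exists>r. \<forall>w. g r w = koszul br g u v w" for u v
    by (rule riesz[OF g])
  then have ex: "\<forall>w. g (SOME r. \<forall>w. g r w = koszul br g u v w) w = koszul br g u v w" for u v
    by (rule someI_ex)
  define D where "D u v = (SOME r. \<forall>w. g r w = koszul br g u v w)" for u v
  have D: "g (D u v) w = koszul br g u v w" for u v w
    using ex unfolding D_def by blast
  have "bilinear D"
    unfolding bilinear_def
    by (intro conjI allI linearI; rule inner_product_eqI[OF g])
      (simp_all add: D inner_simps[OF g] koszul_def br_simps field_simps)
  moreover have "D u v - D v u = br u v" for u v
  proof (rule inner_product_eqI[OF g])
    show "g (D u v - D v u) w = g (br u v) w" for w
      using br_antisym[of v u] br_antisym[of u w] br_antisym[of w v]
      by (simp add: D inner_simps[OF g] koszul_def field_simps)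
  qed
  moreover have "g (D u v) w + g v (D u w) = 0" for u v w
    using br_antisym[of v u] br_antisym[of u w] br_antisym[of w v]
    by (simp add: inner_productD(3)[OF g, of v "D u w"] D inner_simps[OF g] koszul_def field_simps)
  ultimately show ?thesis
    unfolding is_levi_civita_def by blast
qed

lemma levi_civita:
  assumes g: "inner_product g"
  shows "is_levi_civita br g (levi_civita br g)"
proof -
  have "D = D'" if "is_levi_civita br g D" "is_levi_civita br g D'" for D D'
    using that by (intro ext inner_product_eqI[OF g]) (simp add: is_levi_civita_koszul[OF g])
  then have "\<exists>!D. is_levi_civita br g D"
    using levi_civita_exists[OF g] by blast
  then show ?thesis
    unfolding levi_civita_def by (rule theI')
qed

definition christoffel :: "('a \<Rightarrow> 'a \<Rightarrow> real) \<Rightarrow> 'n \<Rightarrow> 'n \<Rightarrow> 'n \<Rightarrow> real" where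
  "christoffel g i j k = coord (levi_civita br g (e i) (e j)) k"

definition struct :: "'n \<Rightarrow> 'n \<Rightarrow> 'n \<Rightarrow> real" where
  "struct i j k = coord (br (e i) (e j)) k"

text \<open>The symbols solve a linear system with the Gram matrix of \<open>g\<close>; in this form
  they can be estimated without an explicit inverse matrix.\<close>

lemma christoffel_koszul:
  assumes g: "inner_product g"
  shows "(\<Sum>k\<in>UNIV. christoffel g i j k * g (e k) (e l)) =
    (\<Sum>m\<in>UNIV. struct i j m * g (e m) (e l) - struct j l m * g (e m) (e i)
      + struct l i m * g (e m) (e j)) / 2"
proof -
  have "(\<Sum>k\<in>UNIV. christoffel g i j k * g (e k) (e l)) = g (levi_civita br g (e i) (e j)) (e l)"
    unfolding christoffel_def by (rule inner_expand[OF g, symmetric])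
  also have "\<dots> = koszul br g (e i) (e j) (e l)"
    by (rule is_levi_civita_koszul[OF g levi_civita[OF g]])
  finally show ?thesis
    unfolding koszul_def struct_def sum.distrib sum_subtractf
    by (simp only: flip: inner_expand[OF g])
qed

text \<open>Ricci becomes a quadratic polynomial in the Christoffel symbols; both the Lipschitz
  estimate and the explicit curvature computations start here.\<close>

lemma ricci_christoffel:
  assumes g: "inner_product g"
  shows "ricci br g (e v) (e w) = (\<Sum>u\<in>UNIV. \<Sum>m\<in>UNIV.
     christoffel g v w m * christoffel g u m u - christoffel g u w m * christoffel g v m u
      - struct u v m * christoffel g m w u)"
proof -
  define D where "D = levi_civita br g"
  have "bilinear D"
    using levi_civita[OF g] by (simp add: D_def is_levi_civita_def)
  then have lin: "linear (D u)" "linear (\<lambda>v. D v u)" for u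
    by (auto simp: bilinear_def)
  have riem: "riemann br g u v w = D u (D v w) - D v (D u w) - D (br u v) w" for u v w
    by (simp add: riemann_def D_def Let_def)
  have linr: "linear (\<lambda>u. riemann br g u v w)" for v w
    unfolding riem
    by (rule linearI)
      (simp_all add: linear_add[OF lin(1)] linear_cmul[OF lin(1)] linear_add[OF lin(2)]
        linear_cmul[OF lin(2)] br_simps algebra_simps)
  have D1: "coord (D x y) k = (\<Sum>m\<in>UNIV. coord y m * coord (D x (e m)) k)"
    and D2: "coord (D x y) k = (\<Sum>m\<in>UNIV. coord x m * coord (D (e m) y) k)" for x y k
    by (subst linear_expand[OF lin(1)], simp add: coord_simps)
      (subst linear_expand[OF lin(2)], simp add: coord_simps)
  have "coord (D (e u) (D (e v) (e w)) - D (e v) (D (e u) (e w)) - D (br (e u) (e v)) (e w)) u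
    = (\<Sum>m\<in>UNIV. christoffel g v w m * christoffel g u m u
      - christoffel g u w m * christoffel g v m u - struct u v m * christoffel g m w u)" for u
    unfolding coord_simps sum_subtractf christoffel_def struct_def D_def[symmetric]
      D1[of "e u" "D (e v) (e w)"] D1[of "e v" "D (e u) (e w)"] D2[of "br (e u) (e v)" "e w"] ..
  then show ?thesis
    unfolding ricci_def riem lin_trace_coord[OF linr[unfolded riem]] by simp
qed

end

section \<open>Dependence of the Ricci tensor on the metric\<close>

text \<open>For the filter \<open>principal S\<close>, a big-O bound means one constant valid at
  every point of \<open>S\<close>.\<close>

lemma bigo_one_compact:
  fixes f :: "real \<Rightarrow> real"
  assumes "compact S" "continuous_on S f"
  shows "f \<in> O[principal S](\<lambda>_. 1)"
proof -
  have "bounded (f ` S)"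
    using assms by (intro compact_imp_bounded compact_continuous_image)
  then obtain C where "\<forall>y\<in>f ` S. norm y \<le> C"
    unfolding bounded_iff by blast
  then show ?thesis
    by (intro bigoI[of _ C]) (auto simp: eventually_principal)
qed

lemma bigo_mult_one:
  assumes "f \<in> O[F](E)" "h \<in> O[F](\<lambda>_. 1)"
  shows "(\<lambda>t. f t * h t :: real) \<in> O[F](E)" "(\<lambda>t. h t * f t) \<in> O[F](E)"
  using landau_o.big.mult[OF assms] landau_o.big.mult[OF assms(2,1)] by simp_all

text \<open>The splitting f h - f' h' = f (h - h') + (f - f') h' lets Lipschitz bounds pass to
  products.\<close>

lemma bigo_mult_diff:
  fixes f :: "'b \<Rightarrow> real"
  assumes "f \<in> O[F](\<lambda>_. 1)" "h' \<in> O[F](\<lambda>_. 1)"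
    and "(\<lambda>t. f t - f' t) \<in> O[F](E)" "(\<lambda>t. h t - h' t) \<in> O[F](E)"
  shows "(\<lambda>t. f t * h t - f' t * h' t) \<in> O[F](E)"
proof -
  have "(\<lambda>t. f t * (h t - h' t) + (f t - f' t) * h' t) \<in> O[F](E)"
    by (intro sum_in_bigo bigo_mult_one assms)
  then show ?thesis
    by (simp add: algebra_simps)
qed

context frame
begin

text \<open>The Gram form is continuous and positive on the compact set of pairs of a time and a
  unit vector, so it has a positive minimum there; homogeneity extends the bound to all
  \<open>z\<close>.\<close>

lemma coercive_compact:
  fixes g :: "real \<Rightarrow> 'a \<Rightarrow> 'a \<Rightarrow> real"
  assumes S: "compact S" and g: "\<And>t. t \<in> S \<Longrightarrow> inner_product (g t)"
    and cont: "\<And>i j. continuous_on S (\<lambda>t. g t (e i) (e j))"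
  obtains c where "c > 0" and "\<And>t z. t \<in> S \<Longrightarrow>
    c * (norm (z :: real^'n))\<^sup>2 \<le> (\<Sum>k\<in>UNIV. \<Sum>l\<in>UNIV. z $ k * z $ l * g t (e k) (e l))"
proof (cases "S = {}")
  case True
  then show thesis
    using that[of 1] by simp
next
  case False
  define q where "q = (\<lambda>(t, z :: real^'n). \<Sum>k\<in>UNIV. \<Sum>l\<in>UNIV. z $ k * z $ l * g t (e k) (e l))"
  define K where "K = S \<times> sphere (0 :: real^'n) 1"
  have "compact K"
    unfolding K_def by (intro compact_Times S compact_sphere)
  moreover have "K \<noteq> {}"
    using False vector_choose_size[of 1] by (auto simp: K_def sphere_def dist_norm)
  moreover have "continuous_on K q"
    unfolding q_def K_def case_prod_beta
    by (intro continuous_intros continuous_on_compose2[OF cont]) auto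
  ultimately obtain m where m: "m \<in> K" "\<And>x. x \<in> K \<Longrightarrow> q m \<le> q x"
    using continuous_attains_inf[of K q] by blast
  have "q m > 0"
  proof -
    obtain t z where tz: "m = (t, z)" "t \<in> S" "norm z = 1"
      using m(1) by (auto simp: K_def)
    define v where "v = (\<Sum>i\<in>UNIV. z $ i *\<^sub>R e i)"
    have coord_v: "coord v i = z $ i" for i
      by (simp add: v_def coord_simps coord_frame if_distrib cong: if_cong)
    have "z \<noteq> 0"
      using tz by auto
    then have "v \<noteq> 0"
      using coord_v linear_0[OF linear_coord] by (auto simp: vec_eq_iff)
    then have "g t v v > 0"
      using inner_productD(4)[OF g] tz by blast
    then show ?thesis
      by (simp add: inner_expand2[OF g[OF tz(2)], of v v] coord_v q_def tz(1))
  qed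
  moreover have "q m * (norm z)\<^sup>2 \<le> q (t, z)" if "t \<in> S" for t z
  proof (cases "z = 0")
    case False
    define w where "w = (1 / norm z) *\<^sub>R z"
    have "norm w = 1"
      using False by (simp add: w_def)
    then have "q m \<le> q (t, w)"
      using m(2) that by (simp add: K_def)
    also have "\<dots> = q (t, z) / (norm z)\<^sup>2"
      by (simp add: q_def w_def sum_divide_distrib power2_eq_square)
    finally show ?thesis
      using False by (simp add: field_simps)
  qed (simp add: q_def)
  ultimately show thesis
    by (intro that) (auto simp: q_def)
qed

text \<open>Coercivity replaces inversion of the Gram matrix: for the right-hand side r,
  Cauchy-Schwarz gives c |z|^2 \<le> z . r \<le> |z| |r|, so r controls z uniformly on
  \<open>S\<close>.\<close>

lemma solution_bigo:
  fixes g :: "real \<Rightarrow> 'a \<Rightarrow> 'a \<Rightarrow> real" and z :: "real \<Rightarrow> 'n \<Rightarrow> real"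
  assumes S: "compact S" and g: "\<And>t. t \<in> S \<Longrightarrow> inner_product (g t)"
    and cont: "\<And>i j. continuous_on S (\<lambda>t. g t (e i) (e j))"
    and rhs: "\<And>l. (\<lambda>t. \<Sum>k\<in>UNIV. z t k * g t (e k) (e l)) \<in> O[principal S](F)"
  shows "(\<lambda>t. z t k) \<in> O[principal S](F)"
proof -
  define r where "r t l = (\<Sum>k\<in>UNIV. z t k * g t (e k) (e l))" for t l
  obtain c where "c > 0" and c: "\<And>t z. t \<in> S \<Longrightarrow>
    c * (norm (z :: real^'n))\<^sup>2 \<le> (\<Sum>k\<in>UNIV. \<Sum>l\<in>UNIV. z $ k * z $ l * g t (e k) (e l))"
    using coercive_compact[of S g] S g cont by blast
  have bound: "\<bar>z t k\<bar> \<le> (\<Sum>l\<in>UNIV. \<bar>r t l\<bar>) / c" if "t \<in> S" for t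
  proof -
    define x y :: "real^'n" where "x = (\<chi> k. z t k)" and "y = (\<chi> l. r t l)"
    have "c * (norm x)\<^sup>2 \<le> (\<Sum>k\<in>UNIV. \<Sum>l\<in>UNIV. x $ k * x $ l * g t (e k) (e l))"
      by (rule c[OF that])
    also have "\<dots> = (\<Sum>l\<in>UNIV. \<Sum>k\<in>UNIV. x $ k * x $ l * g t (e k) (e l))"
      by (rule sum.swap)
    also have "\<dots> = x \<bullet> y"
      by (simp add: inner_vec_def x_def y_def r_def sum_distrib_left mult_ac)
    also have "\<dots> \<le> norm x * norm y"
      by (rule norm_cauchy_schwarz)
    finally have "c * norm x \<le> norm y"
      by (cases "x = 0") (auto simp: power2_eq_square)
    moreover have "norm y \<le> (\<Sum>l\<in>UNIV. \<bar>r t l\<bar>)"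
      using norm_le_l1_cart[of y] by (simp add: y_def)
    moreover have "\<bar>z t k\<bar> \<le> norm x"
      using component_le_norm_cart[of x k] by (simp add: x_def)
    ultimately have "c * \<bar>z t k\<bar> \<le> (\<Sum>l\<in>UNIV. \<bar>r t l\<bar>)"
      using \<open>c > 0\<close> by (meson dual_order.trans less_imp_le mult_left_mono)
    then show ?thesis
      using \<open>c > 0\<close> by (simp add: field_simps)
  qed
  have "(\<lambda>t. z t k) \<in> O[principal S](\<lambda>t. \<Sum>l\<in>UNIV. \<bar>r t l\<bar>)"
    using bound by (intro bigoI[of _ "1 / c"]) (simp add: eventually_principal)
  moreover have "(\<lambda>t. \<Sum>l\<in>UNIV. \<bar>r t l\<bar>) \<in> O[principal S](F)"
    using rhs by (intro big_sum_in_bigo) (simp add: r_def)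
  ultimately show ?thesis
    by (rule landau_o.big_trans)
qed

end

context framed_lie_algebra
begin

text \<open>The right-hand side of the Koszul system is continuous on the compact \<open>S\<close>,
  hence bounded, and \<open>solution_bigo\<close> carries the bound over to the symbols.\<close>

lemma christoffel_bigo:
  fixes g :: "real \<Rightarrow> 'a \<Rightarrow> 'a \<Rightarrow> real"
  assumes S: "compact S" and g: "\<And>t. t \<in> S \<Longrightarrow> inner_product (g t)"
    and cont: "\<And>i j. continuous_on S (\<lambda>t. g t (e i) (e j))"
  shows "(\<lambda>t. christoffel (g t) i j k) \<in> O[principal S](\<lambda>_. 1)"
proof (rule solution_bigo[OF S g cont])
  fix l
  let ?K = "\<lambda>t. (\<Sum>m\<in>UNIV. struct i j m * g t (e m) (e l) - struct j l m * g t (e m) (e i)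
      + struct l i m * g t (e m) (e j)) / 2"
  have "?K \<in> O[principal S](\<lambda>_. 1)"
    by (intro bigo_one_compact S continuous_intros cont) simp
  moreover have "\<forall>\<^sub>F t in principal S.
      (\<Sum>k\<in>UNIV. christoffel (g t) i j k * g t (e k) (e l)) = ?K t"
    using christoffel_koszul[OF g] by (simp add: eventually_principal)
  ultimately show "(\<lambda>t. \<Sum>k\<in>UNIV. christoffel (g t) i j k * g t (e k) (e l)) \<in> O[principal S](\<lambda>_. 1)"
    by (simp only: landau_o.big.in_cong)
qed

lemma christoffel_diff_bigo:
  fixes g h :: "real \<Rightarrow> 'a \<Rightarrow> 'a \<Rightarrow> real"
  assumes S: "compact S"
    and g: "\<And>t. t \<in> S \<Longrightarrow> inner_product (g t)"
    and contg: "\<And>i j. continuous_on S (\<lambda>t. g t (e i) (e j))"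
    and h: "\<And>t. t \<in> S \<Longrightarrow> inner_product (h t)"
    and conth: "\<And>i j. continuous_on S (\<lambda>t. h t (e i) (e j))"
    and E: "\<And>i j. (\<lambda>t. g t (e i) (e j) - h t (e i) (e j)) \<in> O[principal S](E)"
  shows "(\<lambda>t. christoffel (g t) i j k - christoffel (h t) i j k) \<in> O[principal S](E)"
proof (rule solution_bigo[OF S g contg])
  fix l
  let ?d = "\<lambda>t i j. g t (e i) (e j) - h t (e i) (e j)"
  \<comment> \<open>Subtracting the Koszul systems of \<open>g\<close> and \<open>h\<close> leaves a
    system for the difference of the symbols with the Gram matrix of \<open>g\<close>. Its
    right-hand side \<open>?K\<close> is linear in the entries of \<open>g - h\<close>, with bounded
    coefficients.\<close>
  let ?K = "\<lambda>t. (\<Sum>m\<in>UNIV. struct i j m * ?d t m l - struct j l m * ?d t m i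
      + struct l i m * ?d t m j) / 2 - (\<Sum>k\<in>UNIV. christoffel (h t) i j k * ?d t k l)"
  have "(\<lambda>t. \<Sum>m\<in>UNIV. struct i j m * ?d t m l - struct j l m * ?d t m i
      + struct l i m * ?d t m j) \<in> O[principal S](E)"
    by (intro big_sum_in_bigo sum_in_bigo bigo_mult_one(2) E bigo_const)
  then have "?K \<in> O[principal S](E)"
    by (intro sum_in_bigo big_sum_in_bigo bigo_mult_one(2) E christoffel_bigo[OF S h conth]) auto
  moreover have "(\<Sum>k\<in>UNIV. (christoffel (g t) i j k - christoffel (h t) i j k) * g t (e k) (e l))
      = ?K t" if "t \<in> S" for t
    using christoffel_koszul[OF g[OF that], of i j l] christoffel_koszul[OF h[OF that], of i j l]
    by (simp add: algebra_simps sum.distrib sum_subtractf diff_divide_distrib add_divide_distrib)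
  then have "\<forall>\<^sub>F t in principal S.
      (\<Sum>k\<in>UNIV. (christoffel (g t) i j k - christoffel (h t) i j k) * g t (e k) (e l)) = ?K t"
    by (simp add: eventually_principal)
  ultimately show "(\<lambda>t. \<Sum>k\<in>UNIV. (christoffel (g t) i j k - christoffel (h t) i j k) * g t (e k) (e l))
      \<in> O[principal S](E)"
    by (simp only: landau_o.big.in_cong)
qed

text \<open>Lipschitz dependence of Ricci on the metric. The majorant \<open>E\<close> is kept
  abstract so that the Gronwall argument can insert the sum of all deviations.\<close>

lemma ricci_diff_bigo:
  fixes g h :: "real \<Rightarrow> 'a \<Rightarrow> 'a \<Rightarrow> real"
  assumes S: "compact S"
    and g: "\<And>t. t \<in> S \<Longrightarrow> inner_product (g t)"
    and contg: "\<And>i j. continuous_on S (\<lambda>t. g t (e i) (e j))"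
    and h: "\<And>t. t \<in> S \<Longrightarrow> inner_product (h t)"
    and conth: "\<And>i j. continuous_on S (\<lambda>t. h t (e i) (e j))"
    and E: "\<And>i j. (\<lambda>t. g t (e i) (e j) - h t (e i) (e j)) \<in> O[principal S](E)"
  shows "(\<lambda>t. ricci br (g t) (e v) (e w) - ricci br (h t) (e v) (e w)) \<in> O[principal S](E)"
proof -
  let ?c = "\<lambda>t. christoffel (g t)" and ?d = "\<lambda>t. christoffel (h t)"
  let ?K = "\<lambda>t. \<Sum>u\<in>UNIV. \<Sum>m\<in>UNIV. (?c t v w m * ?c t u m u - ?d t v w m * ?d t u m u)
      - (?c t u w m * ?c t v m u - ?d t u w m * ?d t v m u)
      - struct u v m * (?c t m w u - ?d t m w u)"
  have "?K \<in> O[principal S](E)"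
    by (intro big_sum_in_bigo sum_in_bigo(2) bigo_mult_one(2) bigo_mult_diff bigo_const
        christoffel_bigo[OF S h conth] christoffel_bigo[OF S g contg]
        christoffel_diff_bigo[OF S g contg h conth E])
  moreover have "ricci br (g t) (e v) (e w) - ricci br (h t) (e v) (e w) = ?K t" if "t \<in> S" for t
    unfolding ricci_christoffel[OF g[OF that]] ricci_christoffel[OF h[OF that]]
    by (simp add: algebra_simps sum.distrib sum_subtractf)
  then have "\<forall>\<^sub>F t in principal S.
      ricci br (g t) (e v) (e w) - ricci br (h t) (e v) (e w) = ?K t"
    by (simp add: eventually_principal)
  ultimately show ?thesis
    by (simp only: landau_o.big.in_cong)
qed

end

section \<open>Invariant families of diagonal metrics\<close>

text \<open>The sum of squares \<open>E\<close> is differentiable, unlike the sum of absolute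
  values. The bound gives |E'| \<le> 2 C E, so exp (-2 C t) E(t) does not increase, and it starts at
  0.\<close>

lemma gronwall_zero:
  fixes f f' :: "'i \<Rightarrow> real \<Rightarrow> real"
  assumes I: "finite I" and "0 \<le> \<tau>"
    and der: "\<And>i t. i \<in> I \<Longrightarrow> t \<in> {0..\<tau>} \<Longrightarrow>
      (f i has_real_derivative f' i t) (at t within {0..\<tau>})"
    and init: "\<And>i. i \<in> I \<Longrightarrow> f i 0 = 0"
    and bound: "\<And>i. i \<in> I \<Longrightarrow> f' i \<in> O[principal {0..\<tau>}](\<lambda>t. \<Sum>k\<in>I. \<bar>f k t\<bar>)"
    and "i \<in> I"
  shows "f i \<tau> = 0"
proof -
  define s where "s t = (\<Sum>k\<in>I. \<bar>f k t\<bar>)" for t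
  define E where "E t = (\<Sum>k\<in>I. (f k t)\<^sup>2)" for t
  have "f k \<in> O[principal {0..\<tau>}](s)" if "k \<in> I" for k
    using I that
    by (intro bigoI[of _ 1]) (auto simp: eventually_principal s_def intro!: member_le_sum)
  moreover have "f' k \<in> O[principal {0..\<tau>}](s)" if "k \<in> I" for k
    using bound[OF that] unfolding s_def .
  ultimately have "(\<lambda>t. \<Sum>k\<in>I. f k t * f' k t) \<in> O[principal {0..\<tau>}](\<lambda>t. s t * s t)"
    by (intro big_sum_in_bigo landau_o.big.mult) auto
  also have "(\<lambda>t. s t * s t) \<in> O[principal {0..\<tau>}](E)"
  proof (rule bigoI[of _ "card I"])
    \<comment> \<open>Cauchy-Schwarz passes from the squared sum of absolute values to the sum of
      squares, at the price of the factor \<open>card I\<close>.\<close>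
    have "s t * s t \<le> card I * E t" for t
      using sum_squared_le_sum_of_squares[of "\<lambda>k. \<bar>f k t\<bar>" I]
      by (simp add: s_def E_def power2_eq_square mult.commute)
    then have "norm (s t * s t) \<le> card I * norm (E t)" for t
      by (simp add: E_def sum_nonneg)
    then show "\<forall>\<^sub>F t in principal {0..\<tau>}. norm (s t * s t) \<le> card I * norm (E t)"
      by (simp add: eventually_principal)
  qed
  finally have "(\<lambda>t. \<Sum>k\<in>I. f k t * f' k t) \<in> O[principal {0..\<tau>}](E)" .
  then obtain C where "\<forall>t\<in>{0..\<tau>}. \<bar>\<Sum>k\<in>I. f k t * f' k t\<bar> \<le> C * \<bar>E t\<bar>"
    by (elim landau_o.bigE) (auto simp: eventually_principal)
  moreover have "E t \<ge> 0" for t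
    by (simp add: E_def sum_nonneg)
  ultimately have C: "\<bar>\<Sum>k\<in>I. f k t * f' k t\<bar> \<le> C * E t" if "t \<in> {0..\<tau>}" for t
    using that by simp
  define \<phi> where "\<phi> t = exp (- 2 * C * t) * E t" for t
  define \<phi>' where "\<phi>' t = 2 * exp (- 2 * C * t) * ((\<Sum>k\<in>I. f k t * f' k t) - C * E t)" for t
  have \<phi>: "(\<phi> has_real_derivative \<phi>' t) (at t within {0..\<tau>})" if "t \<in> {0..\<tau>}" for t
    unfolding \<phi>_def \<phi>'_def E_def
    by (rule derivative_eq_intros der that refl | assumption)+
      (simp add: algebra_simps sum_distrib_left)
  have "\<phi> \<tau> \<le> \<phi> 0"
  proof (cases "\<tau> = 0")
    case False
    then have "0 < \<tau>"
      using \<open>0 \<le> \<tau>\<close> by simp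
    then obtain x where x: "x \<in> {0<..<\<tau>}" "\<phi> \<tau> - \<phi> 0 = \<phi>' x * (\<tau> - 0)"
      using mvt_simple[of 0 \<tau> \<phi> "\<lambda>x. (*) (\<phi>' x)"] \<phi> by (auto simp: has_field_derivative_def)
    have "\<phi>' x \<le> 0"
      using C[of x] x(1) by (simp add: \<phi>'_def mult_le_0_iff abs_le_iff)
    then show ?thesis
      using x(2) mult_nonpos_nonneg[of "\<phi>' x" \<tau>] \<open>0 \<le> \<tau>\<close> by simp
  qed simp
  also have "\<phi> 0 = 0"
    using init by (simp add: \<phi>_def E_def)
  finally have "E \<tau> \<le> 0"
    by (simp add: \<phi>_def mult_le_0_iff)
  then have "E \<tau> = 0"
    by (simp add: E_def sum_nonneg antisym)
  then show ?thesis
    using I \<open>i \<in> I\<close> by (simp add: E_def sum_nonneg_eq_0_iff)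
qed

context frame
begin

definition diag_metric :: "('n \<Rightarrow> real) \<Rightarrow> 'a \<Rightarrow> 'a \<Rightarrow> real" where
  "diag_metric \<mu> u v = (\<Sum>i\<in>UNIV. \<mu> i * coord u i * coord v i)"

lemma diag_metric_frame: "diag_metric \<mu> (e i) (e j) = (if i = j then \<mu> i else 0)"
  by (simp add: diag_metric_def coord_frame if_distrib[where f="\<lambda>x. _ * x"] cong: if_cong)

lemma inner_product_diag_metric:
  assumes "\<And>i. \<mu> i > 0"
  shows "inner_product (diag_metric \<mu>)"
  unfolding inner_product_def
proof (intro conjI allI impI)
  show "bilinear (diag_metric \<mu>)"
    unfolding bilinear_def diag_metric_def
    by (auto intro!: linearI simp: coord_simps algebra_simps sum.distrib sum_distrib_left)
  show "diag_metric \<mu> u v = diag_metric \<mu> v u" for u v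
    by (simp add: diag_metric_def mult_ac)
  fix u :: 'a assume "u \<noteq> 0"
  then obtain i where "coord u i \<noteq> 0"
    using expand[of u] by (metis (no_types, lifting) scaleR_zero_left sum.neutral)
  then show "diag_metric \<mu> u u > 0"
    unfolding diag_metric_def
    using assms
    by (intro sum_pos2[of _ i])
      (auto simp: mult.assoc less_imp_le zero_less_mult_iff linorder_neq_iff)
qed

end

context framed_lie_algebra
begin

text \<open>
  The idempotent map \<open>r\<close> selects representatives of the classes of frame vectors on which all
  metrics of the family take the same value.
\<close>

lemma ricci_flow_stays_in_diagonal_family:
  assumes flow: "ricci_flow_on br g T"
    and init: "\<And>i j. g 0 (e i) (e j) = (if i = j then g 0 (e (r i)) (e (r i)) else 0)"
    and idem: "\<And>i. r (r i) = r i"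
    and tangent: "\<And>\<mu> i j. (\<And>i. \<mu> i > 0) \<Longrightarrow> (\<And>i. \<mu> (r i) = \<mu> i) \<Longrightarrow>
      ricci br (diag_metric \<mu>) (e i) (e j) =
        (if i = j then ricci br (diag_metric \<mu>) (e (r i)) (e (r i)) else 0)"
    and \<tau>: "\<tau> \<in> time_interval T"
  shows "g \<tau> (e i) (e j) = (if i = j then g \<tau> (e (r i)) (e (r i)) else 0)"
proof -
  define S where "S = {0..\<tau>}"
  have "0 \<le> \<tau>" and S: "compact S" "S \<subseteq> time_interval T"
    using \<tau> by (auto simp: S_def time_interval_def intro: le_less_trans[of "ereal _" "ereal \<tau>"])
  have g: "inner_product (g t)" if "t \<in> S" for t
    using flow S(2) that by (auto simp: ricci_flow_on_def)
  have der: "((\<lambda>s. g s u v) has_real_derivative - 2 * ricci br (g t) u v) (at t within S)"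
    if "t \<in> S" for t u v
    using flow S(2) that unfolding ricci_flow_on_def
    by (blast intro: has_field_derivative_subset)
  have contg: "continuous_on S (\<lambda>t. g t u v)" for u v
    by (rule DERIV_continuous_on) (rule der)
  \<comment> \<open>\<open>p t\<close> projects \<open>g t\<close> to the family by reading the
    diagonal entries at the representatives. The flow is compared with its own projection, so no
    solution inside the family has to be constructed.\<close>
  define \<mu> where "\<mu> t i = g t (e (r i)) (e (r i))" for t i
  define p where "p t = diag_metric (\<mu> t)" for t
  have e: "e i \<noteq> 0" for i
    using independent_frame by (metis dependent_zero rangeI)
  have \<mu>_pos: "\<mu> t i > 0" if "t \<in> S" for t i
    using inner_productD(4)[OF g[OF that] e] by (simp add: \<mu>_def)
  have p: "inner_product (p t)" if "t \<in> S" for t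
    unfolding p_def by (intro inner_product_diag_metric \<mu>_pos that)
  have p_frame: "p t (e i) (e j) = (if i = j then \<mu> t i else 0)" for t i j
    by (simp add: p_def diag_metric_frame)
  have contp: "continuous_on S (\<lambda>t. p t (e i) (e j))" for i j
    unfolding p_frame \<mu>_def by (cases "i = j") (auto intro: contg)
  define f where "f = (\<lambda>(i, j) t. g t (e i) (e j) - p t (e i) (e j))"
  define d where "d t i j = ricci br (g t) (e i) (e j) - ricci br (p t) (e i) (e j)" for t i j
  \<comment> \<open>The derivative of the projection contains Ricci of \<open>g\<close> at the
    representatives. Tangency of Ricci at \<open>p t\<close> allows Ricci of \<open>p t\<close> to
    be inserted in both terms, so only the differences \<open>d\<close> remain.\<close>
  define f' where "f' = (\<lambda>(i, j) t. - 2 * d t i j + (if i = j then 2 * d t (r i) (r i) else 0))"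
  have "(f ij has_real_derivative f' ij t) (at t within S)" if t: "t \<in> S" for ij t
  proof (cases ij)
    case (Pair i j)
    have tan: "ricci br (p t) (e i) (e j) = (if i = j then ricci br (p t) (e (r i)) (e (r i)) else 0)"
      unfolding p_def by (intro tangent \<mu>_pos t) (simp add: \<mu>_def idem)
    have "((\<lambda>t. g t (e i) (e j) - (if i = j then g t (e (r i)) (e (r i)) else 0)) has_real_derivative
        - 2 * ricci br (g t) (e i) (e j)
          - (if i = j then - 2 * ricci br (g t) (e (r i)) (e (r i)) else 0)) (at t within S)"
      using DERIV_diff[OF der[OF t, of "e i" "e j"] der[OF t, of "e (r i)" "e (r i)"]]
        der[OF t, of "e i" "e j"] by (cases "i = j") simp_all
    then show ?thesis
      using tan by (auto simp: Pair f_def f'_def d_def p_frame \<mu>_def algebra_simps split: if_splits)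
  qed
  moreover have "f ij 0 = 0" for ij
  proof (cases ij)
    case (Pair i j)
    show ?thesis
      using init[of i j] unfolding Pair f_def p_frame \<mu>_def by simp
  qed
  moreover have "f' ij \<in> O[principal S](\<lambda>t. \<Sum>k\<in>UNIV. \<bar>f k t\<bar>)" for ij
  proof -
    \<comment> \<open>Every entry of \<open>g - p\<close> is a component of \<open>f\<close>, so the
      sum of all |f k t| is a majorant for \<open>ricci_diff_bigo\<close>, and it is the one that
      \<open>gronwall_zero\<close> asks for.\<close>
    have "(\<lambda>t. g t (e i) (e j) - p t (e i) (e j)) \<in> O[principal S](\<lambda>t. \<Sum>k\<in>UNIV. \<bar>f k t\<bar>)" for i j
    proof (rule bigoI[of _ 1])
      have "\<bar>f (i, j) t\<bar> \<le> (\<Sum>k\<in>UNIV. \<bar>f k t\<bar>)" for t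
        by (rule member_le_sum) auto
      then show "\<forall>\<^sub>F t in principal S. norm (g t (e i) (e j) - p t (e i) (e j))
          \<le> 1 * norm (\<Sum>k\<in>UNIV. \<bar>f k t\<bar>)"
        by (simp add: f_def eventually_principal sum_nonneg)
    qed
    then have d: "(\<lambda>t. d t i j) \<in> O[principal S](\<lambda>t. \<Sum>k\<in>UNIV. \<bar>f k t\<bar>)" for i j
      unfolding d_def by (intro ricci_diff_bigo S g contg p contp)
    obtain i j where "ij = (i, j)"
      by (cases ij)
    then show ?thesis
      using d by (cases "i = j") (auto simp: f'_def intro!: sum_in_bigo)
  qed
  ultimately have "f (i, j) \<tau> = 0"
    by (intro gronwall_zero[of UNIV \<tau> f f']) (simp_all add: S_def \<open>0 \<le> \<tau>\<close>)
  then show ?thesis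
    by (simp add: f_def p_frame \<mu>_def)
qed

text \<open>A diagonal Gram matrix decouples the Koszul system into one equation per symbol.\<close>

lemma christoffel_diag_metric:
  assumes "\<And>i. \<mu> i > 0"
  shows "christoffel (diag_metric \<mu>) i j k =
    (struct i j k * \<mu> k - struct j k i * \<mu> i + struct k i j * \<mu> j) / (2 * \<mu> k)"
proof -
  have "christoffel (diag_metric \<mu>) i j k * \<mu> k =
    (struct i j k * \<mu> k - struct j k i * \<mu> i + struct k i j * \<mu> j) / 2"
    using christoffel_koszul[OF inner_product_diag_metric[of \<mu>, OF assms], of i j k]
    by (simp add: diag_metric_frame sum.distrib sum_subtractf if_distrib[where f="\<lambda>x. _ * x"]
        cong: if_cong)
  then show ?thesis
    using assms[of k] by (simp add: field_simps)
qed

end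

section \<open>The Lie algebra of \<open>SU(2) \<times> \<real>\<close>\<close>

text \<open>These are the brackets of the frame \<open>Y\<close>. As the vector X4 is central, the
  bracket of \<open>e i\<close> with \<open>e 4\<close>, for i = 1, 2, 3, is the cross product of
  the i-th unit vector with (a1, a2, a3).\<close>

locale su2_line = framed_lie_algebra br e
  for br :: "'a::real_vector \<Rightarrow> 'a \<Rightarrow> 'a" and e :: "4 \<Rightarrow> 'a" +
  fixes a1 a2 a3 :: real
  assumes e12: "br (e 1) (e 2) = e 3" and e23: "br (e 2) (e 3) = e 1" and e31: "br (e 3) (e 1) = e 2"
    and e14: "br (e 1) (e 4) = a2 *\<^sub>R e 3 - a3 *\<^sub>R e 2"
    and e24: "br (e 2) (e 4) = a3 *\<^sub>R e 1 - a1 *\<^sub>R e 3"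
    and e34: "br (e 3) (e 4) = a1 *\<^sub>R e 2 - a2 *\<^sub>R e 1"
begin

lemma brackets:
  "br (e i) (e i) = 0"
  "br (e 2) (e 1) = - e 3" "br (e 3) (e 2) = - e 1" "br (e 1) (e 3) = - e 2"
  "br (e 4) (e 1) = a3 *\<^sub>R e 2 - a2 *\<^sub>R e 3"
  "br (e 4) (e 2) = a1 *\<^sub>R e 3 - a3 *\<^sub>R e 1"
  "br (e 4) (e 3) = a2 *\<^sub>R e 1 - a1 *\<^sub>R e 2"
  using br_antisym[of "e 2" "e 1"] br_antisym[of "e 3" "e 2"] br_antisym[of "e 1" "e 3"]
    br_antisym[of "e 4" "e 1"] br_antisym[of "e 4" "e 2"] br_antisym[of "e 4" "e 3"]
  by (simp_all add: e12 e23 e31 e14 e24 e34 alternating)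

lemmas struct_table = struct_def brackets e12 e23 e31 e14 e24 e34 coord_simps coord_frame

text \<open>The obstruction to staying diagonal: as the denominators are positive, each entry
  vanishes exactly when its coefficient is zero or the other two metric entries agree.\<close>

lemma ricci_diag_metric_line:
  assumes "\<And>i. \<mu> i > 0"
  shows "ricci br (diag_metric \<mu>) (e 1) (e 4) = - a1 * (\<mu> 2 - \<mu> 3)\<^sup>2 / (2 * \<mu> 2 * \<mu> 3)"
    and "ricci br (diag_metric \<mu>) (e 2) (e 4) = - a2 * (\<mu> 3 - \<mu> 1)\<^sup>2 / (2 * \<mu> 3 * \<mu> 1)"
    and "ricci br (diag_metric \<mu>) (e 3) (e 4) = - a3 * (\<mu> 1 - \<mu> 2)\<^sup>2 / (2 * \<mu> 1 * \<mu> 2)"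
proof -
  have nz: "\<mu> i \<noteq> 0" for i
    using assms[of i] by simp
  note ric = ricci_christoffel inner_product_diag_metric assms christoffel_diag_metric sum_4
    struct_table
  show "ricci br (diag_metric \<mu>) (e 1) (e 4) = - a1 * (\<mu> 2 - \<mu> 3)\<^sup>2 / (2 * \<mu> 2 * \<mu> 3)"
    and "ricci br (diag_metric \<mu>) (e 2) (e 4) = - a2 * (\<mu> 3 - \<mu> 1)\<^sup>2 / (2 * \<mu> 3 * \<mu> 1)"
    and "ricci br (diag_metric \<mu>) (e 3) (e 4) = - a3 * (\<mu> 1 - \<mu> 2)\<^sup>2 / (2 * \<mu> 1 * \<mu> 2)"
    \<comment> \<open>The first \<open>simp\<close> expands Ricci through the Christoffel symbols
      and structure constants into a rational function of \<open>\<mu>\<close>; the second clears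
      the nonzero denominators.\<close>
    by (simp add: ric, simp add: nz field_simps power2_eq_square)+
qed

text \<open>Under the adaptedness condition the diagonal values are the familiar ones for diagonal
  left-invariant metrics on SU(2), free of \<open>a1\<close>, \<open>a2\<close>,
  \<open>a3\<close>.\<close>

lemma ricci_diag_metric:
  assumes "\<And>i. \<mu> i > 0"
    and "a1 = 0 \<or> \<mu> 2 = \<mu> 3" "a2 = 0 \<or> \<mu> 3 = \<mu> 1" "a3 = 0 \<or> \<mu> 1 = \<mu> 2"
  shows "i \<noteq> j \<Longrightarrow> ricci br (diag_metric \<mu>) (e i) (e j) = 0"
    and "ricci br (diag_metric \<mu>) (e 1) (e 1) = ((\<mu> 1)\<^sup>2 - (\<mu> 2 - \<mu> 3)\<^sup>2) / (2 * \<mu> 2 * \<mu> 3)"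
    and "ricci br (diag_metric \<mu>) (e 2) (e 2) = ((\<mu> 2)\<^sup>2 - (\<mu> 3 - \<mu> 1)\<^sup>2) / (2 * \<mu> 3 * \<mu> 1)"
    and "ricci br (diag_metric \<mu>) (e 3) (e 3) = ((\<mu> 3)\<^sup>2 - (\<mu> 1 - \<mu> 2)\<^sup>2) / (2 * \<mu> 1 * \<mu> 2)"
proof -
  have nz: "\<mu> i \<noteq> 0" for i
    using assms(1)[of i] by simp
  note ric = ricci_christoffel inner_product_diag_metric assms(1) christoffel_diag_metric sum_4
    struct_table
  \<comment> \<open>Two equalities among the entries force the third, so the eight combinations
    reduce to five. The equalities point to the smaller index to serve as rewrite rules.\<close>
  have cases: "(a1 = 0 \<and> a2 = 0 \<and> a3 = 0) \<or> (a2 = 0 \<and> a3 = 0 \<and> \<mu> 3 = \<mu> 2)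
      \<or> (a1 = 0 \<and> a3 = 0 \<and> \<mu> 3 = \<mu> 1) \<or> (a1 = 0 \<and> a2 = 0 \<and> \<mu> 2 = \<mu> 1)
      \<or> (\<mu> 2 = \<mu> 1 \<and> \<mu> 3 = \<mu> 1)"
    using assms(2-4) by auto
  have "\<forall>i j. i \<noteq> j \<longrightarrow> ricci br (diag_metric \<mu>) (e i) (e j) = 0"
    unfolding forall_4
    by (intro conjI impI; (simp add: ric)?; (insert cases, elim disjE; simp add: nz field_simps)?)
  then show "i \<noteq> j \<Longrightarrow> ricci br (diag_metric \<mu>) (e i) (e j) = 0"
    by blast
  show "ricci br (diag_metric \<mu>) (e 1) (e 1) = ((\<mu> 1)\<^sup>2 - (\<mu> 2 - \<mu> 3)\<^sup>2) / (2 * \<mu> 2 * \<mu> 3)"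
    and "ricci br (diag_metric \<mu>) (e 2) (e 2) = ((\<mu> 2)\<^sup>2 - (\<mu> 3 - \<mu> 1)\<^sup>2) / (2 * \<mu> 3 * \<mu> 1)"
    and "ricci br (diag_metric \<mu>) (e 3) (e 3) = ((\<mu> 3)\<^sup>2 - (\<mu> 1 - \<mu> 2)\<^sup>2) / (2 * \<mu> 1 * \<mu> 2)"
    by (simp add: ric, insert cases, elim disjE; simp add: nz field_simps power2_eq_square)+
qed

section \<open>The diagonality criterion for the flow\<close>

text \<open>Entries that stay zero have one-sided derivative zero at time \<open>0\<close>, so the
  flow equation makes the off-diagonal Ricci entries of the initial metric vanish; those with second
  index \<open>4\<close> give the condition.\<close>

lemma ricci_flow_diagonal_imp:
  assumes flow: "ricci_flow_on br g T"
    and init: "\<And>i j. g 0 (e i) (e j) = (if i = j then \<mu> i else 0)"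
    and pos: "\<And>i. \<mu> i > 0"
    and diag: "\<And>t i j. t \<in> time_interval T \<Longrightarrow> i \<noteq> j \<Longrightarrow> g t (e i) (e j) = 0"
  shows "(a1 = 0 \<or> \<mu> 2 = \<mu> 3) \<and> (a2 = 0 \<or> \<mu> 3 = \<mu> 1) \<and> (a3 = 0 \<or> \<mu> 1 = \<mu> 2)"
proof -
  have "ereal 0 < T"
    using flow by (simp add: ricci_flow_on_def zero_ereal_def)
  \<comment> \<open>As \<open>T\<close> may be infinite, a real \<open>\<tau>\<close> provides a
    closed nondegenerate interval on which the one-sided derivative at \<open>0\<close> is
    unique.\<close>
  then obtain \<tau> where \<tau>: "0 < \<tau>" "ereal \<tau> < T"
    using ereal_dense2 by force
  then have sub: "{0..\<tau>} \<subseteq> time_interval T"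
    by (auto simp: time_interval_def intro: le_less_trans[of "ereal _" "ereal \<tau>"])
  then have 0: "0 \<in> time_interval T"
    using \<tau> by auto
  then have "inner_product (g 0)"
    using flow by (simp add: ricci_flow_on_def)
  then have g0: "g 0 = diag_metric \<mu>"
    by (intro ext) (simp add: inner_expand2[of "g 0"] init diag_metric_def mult_ac
        if_distrib[where f="\<lambda>x. _ * x"] cong: if_cong)
  have "ricci br (diag_metric \<mu>) (e i) (e j) = 0" if "i \<noteq> j" for i j
  proof -
    have "((\<lambda>t. g t (e i) (e j)) has_real_derivative - 2 * ricci br (g 0) (e i) (e j))
        (at 0 within {0..\<tau>})"
      using flow 0 sub unfolding ricci_flow_on_def by (blast intro: has_field_derivative_subset)
    moreover have "((\<lambda>t. g t (e i) (e j)) has_real_derivative 0) (at 0 within {0..\<tau>})"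
      by (rule has_field_derivative_transform_within[OF DERIV_const[of 0], of 1])
        (use diag sub that \<tau> in auto)
    ultimately have "- 2 * ricci br (g 0) (e i) (e j) = 0"
      unfolding has_real_derivative_iff_has_vector_derivative using \<tau>(1)
      by (intro vector_derivative_unique_within_closed_interval[of 0 \<tau> 0]) auto
    then show ?thesis
      by (simp add: g0)
  qed
  from this[of 1 4] this[of 2 4] this[of 3 4] show ?thesis
    using ricci_diag_metric_line[of \<mu>, OF pos] pos[of 1] pos[of 2] pos[of 3] by auto
qed

lemma ricci_flow_diagonal_if:
  assumes flow: "ricci_flow_on br g T"
    and init: "\<And>i j. g 0 (e i) (e j) = (if i = j then \<mu> i else 0)"
    and adapted: "a1 = 0 \<or> \<mu> 2 = \<mu> 3" "a2 = 0 \<or> \<mu> 3 = \<mu> 1" "a3 = 0 \<or> \<mu> 1 = \<mu> 2"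
    and t: "t \<in> time_interval T" and "i \<noteq> j"
  shows "g t (e i) (e j) = 0"
proof -
  \<comment> \<open>Each of the first three indices is sent to the first of them with the same
    entry. Index \<open>4\<close> is always its own class, even if its entry coincides with another,
    because the condition relates only the first three.\<close>
  define r :: "4 \<Rightarrow> 4" where
    "r i = (if i = 4 then 4 else if \<mu> i = \<mu> 1 then 1 else if \<mu> i = \<mu> 2 then 2 else i)" for i
  have idem: "r (r i) = r i" for i
    by (simp add: r_def)
  have \<mu>_r: "\<mu> (r i) = \<mu> i" for i
    by (simp add: r_def)
  have tangent: "ricci br (diag_metric \<nu>) (e i) (e j) =
      (if i = j then ricci br (diag_metric \<nu>) (e (r i)) (e (r i)) else 0)"
    if pos: "\<And>i. \<nu> i > 0" and \<nu>_r: "\<And>i. \<nu> (r i) = \<nu> i" for \<nu> i j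
  proof -
    \<comment> \<open>Invariance under \<open>r\<close> makes \<open>\<nu>\<close> inherit the
      equalities among the first three entries of \<open>\<mu>\<close>, so adaptedness passes from
      \<open>\<mu>\<close> to \<open>\<nu>\<close>.\<close>
    have eq: "\<mu> 2 = \<mu> 1 \<Longrightarrow> \<nu> 2 = \<nu> 1" "\<mu> 3 = \<mu> 1 \<Longrightarrow> \<nu> 3 = \<nu> 1" "\<mu> 3 = \<mu> 2 \<Longrightarrow> \<nu> 3 = \<nu> 2"
      using \<nu>_r[of 2] \<nu>_r[of 3] by (auto simp: r_def split: if_splits)
    then have "a1 = 0 \<or> \<nu> 2 = \<nu> 3" "a2 = 0 \<or> \<nu> 3 = \<nu> 1" "a3 = 0 \<or> \<nu> 1 = \<nu> 2"
      using adapted by metis+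
    note ric = ricci_diag_metric[of \<nu>, OF pos this]
    have "ricci br (diag_metric \<nu>) (e i) (e i) = ricci br (diag_metric \<nu>) (e (r i)) (e (r i))" for i
      using exhaust_4[of i]
      by (elim disjE) (auto simp: r_def ric eq power2_commute mult_ac)
    then show ?thesis
      using ric(1)[of i j] by (cases "i = j") auto
  qed
  have init': "g 0 (e i) (e j) = (if i = j then g 0 (e (r i)) (e (r i)) else 0)" for i j
    by (simp add: init \<mu>_r)
  show ?thesis
    using ricci_flow_stays_in_diagonal_family[of g T r, OF flow init' idem tangent t, of i j]
      \<open>i \<noteq> j\<close> by simp
qed

end

section \<open>Translation to natural-number indices and the three cases\<close>

theorem proposition9:
  fixes br :: "'a::real_vector \<Rightarrow> 'a \<Rightarrow> 'a"
    and X Y :: "nat \<Rightarrow> 'a"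
    and a lam :: "nat \<Rightarrow> real"
    and g0 :: "'a \<Rightarrow> 'a \<Rightarrow> real"
    and g :: "real \<Rightarrow> 'a \<Rightarrow> 'a \<Rightarrow> real"
    and T :: ereal
  assumes "lie_algebra br"
    and "basis_family X {1..4}"
    and "br (X 1) (X 4) = 0" and "br (X 2) (X 4) = 0" and "br (X 3) (X 4) = 0"
    and "br (X 2) (X 3) = X 1" and "br (X 3) (X 1) = X 2" and "br (X 1) (X 2) = X 3"
    and "Y 1 = X 1" and "Y 2 = X 2" and "Y 3 = X 3"
    and "Y 4 = a 1 *\<^sub>R X 1 + a 2 *\<^sub>R X 2 + a 3 *\<^sub>R X 3 + X 4"
    and "inner_product g0"
    and "\<forall>i\<in>{1..4}. lam i > 0"
    and "\<forall>i\<in>{1..4}. \<forall>j\<in>{1..4}. g0 (Y i) (Y j) = (if i = j then lam i else 0)"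
    and "maximal_ricci_flow br g T"
    and "g 0 = g0"
  shows "(lam 1 \<noteq> lam 2 \<and> lam 2 \<noteq> lam 3 \<and> lam 1 \<noteq> lam 3 \<longrightarrow>
            (remains_diagonal g T Y {1..4} \<longleftrightarrow> a 1 = 0 \<and> a 2 = 0 \<and> a 3 = 0)) \<and>
         (\<forall>i j k. {i, j, k} = {1, 2, 3} \<and> lam j = lam k \<and> lam k \<noteq> lam i \<longrightarrow>
            (remains_diagonal g T Y {1..4} \<longleftrightarrow> a j = 0 \<and> a k = 0)) \<and>
         (lam 1 = lam 2 \<and> lam 2 = lam 3 \<longrightarrow> remains_diagonal g T Y {1..4})"
proof -
  interpret lie_algebra br by fact
  \<comment> \<open>In the type \<open>4\<close> the numeral \<open>4\<close> equals
    \<open>0\<close>; the last branch gives this element the natural index 4.\<close>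
  define idx :: "4 \<Rightarrow> nat" where
    "idx i = (if i = 1 then 1 else if i = 2 then 2 else if i = 3 then 3 else 4)" for i
  define e where "e i = Y (idx i)" for i
  have idx: "idx 1 = 1" "idx 2 = 2" "idx 3 = 3" "idx 4 = 4"
    by (simp_all add: idx_def)
  have atLeast: "{1..4::nat} = {1, 2, 3, 4}"
    by auto
  have idx_range: "range idx = {1..4}"
    unfolding UNIV_4 atLeast by (simp add: idx)
  have "\<forall>i j. idx i = idx j \<longrightarrow> i = j"
    unfolding forall_4 by (simp add: idx)
  then have inj_idx: "inj idx"
    by (blast intro: injI)
  have e: "e 1 = X 1" "e 2 = X 2" "e 3 = X 3"
      "e 4 = a 1 *\<^sub>R X 1 + a 2 *\<^sub>R X 2 + a 3 *\<^sub>R X 3 + X 4"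
    using assms(9-12) by (simp_all add: e_def idx)
  define S where "S = {X 1, X 2, X 3}"
  have "X ` {1..4} = insert (X 4) S"
    unfolding atLeast S_def by auto
  then have basis: "inj_on X {1..4}" "independent (insert (X 4) S)" "span (insert (X 4) S) = UNIV"
    using assms(2) unfolding basis_family_def by metis+
  have distinct: "X 1 \<noteq> X 2" "X 1 \<noteq> X 3" "X 2 \<noteq> X 3" "X 4 \<notin> S"
    using basis(1) unfolding atLeast S_def inj_on_def by auto
  \<comment> \<open>\<open>v\<close> is the part of \<open>Y 4\<close> in the span of
    \<open>S\<close>, so replacing \<open>X 4\<close> by \<open>v + X 4\<close> yields a basis
    again.\<close>
  define v where "v = a 1 *\<^sub>R X 1 + a 2 *\<^sub>R X 2 + a 3 *\<^sub>R X 3"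
  have v: "v \<in> span S"
    unfolding v_def S_def by (intro span_add span_scale span_base) auto
  have e4: "e 4 = v + X 4"
    by (simp add: e v_def)
  have indep: "X 4 \<notin> span S" "independent S"
    using basis(2) distinct(4) by (simp_all add: independent_insert)
  have not_span: "e 4 \<notin> span S"
    using indep(1) v span_add_eq[of v S "X 4"] by (simp add: e4)
  have range_e: "range e = insert (e 4) S"
    unfolding UNIV_4 by (auto simp: e S_def)
  have "frame e"
  proof
    have "e 4 \<noteq> e 1" "e 4 \<noteq> e 2" "e 4 \<noteq> e 3"
      using not_span by (auto simp: e(1-3) S_def span_base)
    then have "\<forall>i j. e i = e j \<longrightarrow> i = j"
      using distinct unfolding forall_4 by (auto simp: e(1-3))
    then show "inj e"
      by (blast intro: injI)
    show "independent (range e)"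
      unfolding range_e using not_span indep(2) by (simp add: independent_insert span_base)
    have "v \<in> span (insert (e 4) S)"
      using v span_mono[of S "insert (e 4) S"] by blast
    then have "e 4 - v \<in> span (insert (e 4) S)"
      by (rule span_diff[OF span_base[OF insertI1]])
    then have "X 4 \<in> span (insert (e 4) S)"
      by (simp add: e4)
    then have "insert (X 4) S \<subseteq> span (insert (e 4) S)"
      by (auto intro: span_base)
    then show "span (range e) = UNIV"
      using span_minimal[OF _ subspace_span] basis(3) unfolding range_e by blast
  qed
  then interpret framed_lie_algebra br e
    by (intro framed_lie_algebra.intro lie_algebra_axioms)
  interpret su2_line br e "a 1" "a 2" "a 3"
  proof
    have anti: "br (X 2) (X 1) = - X 3" "br (X 3) (X 2) = - X 1" "br (X 1) (X 3) = - X 2"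
      using br_antisym[of "X 2" "X 1"] br_antisym[of "X 3" "X 2"] br_antisym[of "X 1" "X 3"]
        assms(6-8) by (simp_all del: One_nat_def)
    show "br (e 1) (e 2) = e 3" "br (e 2) (e 3) = e 1" "br (e 3) (e 1) = e 2"
      "br (e 1) (e 4) = a 2 *\<^sub>R e 3 - a 3 *\<^sub>R e 2"
      "br (e 2) (e 4) = a 3 *\<^sub>R e 1 - a 1 *\<^sub>R e 3"
      "br (e 3) (e 4) = a 1 *\<^sub>R e 2 - a 2 *\<^sub>R e 1"
      by (simp_all add: e br_simps assms(3-8) anti alternating del: One_nat_def)
  qed
  have flow: "ricci_flow_on br g T"
    using assms(16) by (simp add: maximal_ricci_flow_def)
  have idx_in: "idx i \<in> {1..4}" for i
    using idx_range by blast
  have pos: "lam (idx i) > 0" for i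
    using assms(14) idx_in by blast
  have init: "g 0 (e i) (e j) = (if i = j then lam (idx i) else 0)" for i j
    using assms(15) idx_in inj_idx by (simp add: e_def assms(17) inj_eq)
  have diag: "remains_diagonal g T Y {1..4} \<longleftrightarrow>
      (\<forall>t\<in>time_interval T. \<forall>i j. i \<noteq> j \<longrightarrow> g t (e i) (e j) = 0)"
    unfolding remains_diagonal_def idx_range[symmetric] e_def using inj_idx
    by (auto simp: inj_eq)
  \<comment> \<open>All three claims are read off from this one equivalence by inserting the
    equalities among the first three \<open>lam\<close>.\<close>
  have key: "remains_diagonal g T Y {1..4} \<longleftrightarrow> (a 1 = 0 \<or> lam 2 = lam 3) \<and>
      (a 2 = 0 \<or> lam 3 = lam 1) \<and> (a 3 = 0 \<or> lam 1 = lam 2)"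
    (is "_ \<longleftrightarrow> ?adapted")
  proof
    assume "remains_diagonal g T Y {1..4}"
    then show ?adapted
      using ricci_flow_diagonal_imp[of g T "\<lambda>i. lam (idx i)", OF flow init pos]
      unfolding diag idx by blast
  next
    assume ?adapted
    then show "remains_diagonal g T Y {1..4}"
      using ricci_flow_diagonal_if[of g T "\<lambda>i. lam (idx i)", OF flow init]
      unfolding diag idx by blast
  qed
  show ?thesis
  proof (intro conjI allI impI)
    fix i j k :: nat
    assume ijk: "{i, j, k} = {1, 2, 3} \<and> lam j = lam k \<and> lam k \<noteq> lam i"
    \<comment> \<open>That \<open>j\<close> and \<open>k\<close> differ must come from cardinality,
      since \<open>lam\<close> agrees on them; \<open>lam\<close> itself separates \<open>i\<close>
      from both.\<close>
    have "card {i, j, k} = 3"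
      using ijk by simp
    then have "j \<noteq> k"
      by (auto simp: card_insert_if split: if_splits)
    moreover have "i \<noteq> j" "i \<noteq> k"
      using ijk by auto
    moreover have "i = 1 \<or> i = 2 \<or> i = 3" "j = 1 \<or> j = 2 \<or> j = 3" "k = 1 \<or> k = 2 \<or> k = 3"
      using ijk by blast+
    ultimately have "i = 1 \<and> j = 2 \<and> k = 3 \<or> i = 1 \<and> j = 3 \<and> k = 2 \<or> i = 2 \<and> j = 1 \<and> k = 3
        \<or> i = 2 \<and> j = 3 \<and> k = 1 \<or> i = 3 \<and> j = 1 \<and> k = 2 \<or> i = 3 \<and> j = 2 \<and> k = 1"
      by metis
    moreover have "lam j = lam k" "lam k \<noteq> lam i"
      using ijk by auto
    ultimately show "remains_diagonal g T Y {1..4} \<longleftrightarrow> a j = 0 \<and> a k = 0"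
      unfolding key by metis
  next
    show "remains_diagonal g T Y {1..4} \<longleftrightarrow> a 1 = 0 \<and> a 2 = 0 \<and> a 3 = 0"
      if "lam 1 \<noteq> lam 2 \<and> lam 2 \<noteq> lam 3 \<and> lam 1 \<noteq> lam 3"
      using that unfolding key by metis
    show "remains_diagonal g T Y {1..4}" if "lam 1 = lam 2 \<and> lam 2 = lam 3"
      using that unfolding key by metis
  qed
qed

end
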